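(* Let $p,q\in[1,\infty]$. The following two conditions are equivalent. (1) The estimate \[ \|f\ast g\|_{\ell^q(\mathbb{Z}^d)} \leq \|f\|_{\ell^p(\{0,1\}^d)} \|g\|_{\ell^p(\{0,1\}^d)} \] holds for every positive integer $d$ and all functions $f,g\colon\mathbb{Z}^d\to\mathbb{C}$ supported in $\{0,1\}^d$. (2) The exponents $p,q$ satisfy \[ \frac{1}{p} \geq \begin{cases} \displaystyle\frac{1}{2q}\log_2(2^q+2) & \text{for } q\in[1,\infty), \\ \displaystyle\frac{1}{2} & \text{for } q=\infty. \end{cases} \]
   Context: The convolution is $(f\ast g)(x) := \sum_{y\in\mathbb{Z}^d} f(x-y) g(y)$ for $x\in\mathbb{Z}^d$. The $\ell^p$ norms are with respect to counting measure, and $1/\infty=0$. *)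

theory Defs
  imports "HOL-Analysis.Infinite_Sum" "HOL-Library.Extended_Real" Complex_Main
begin

(* The dimension d is quantified inside the statement, so a point of Z^d is a function
   nat => int whose coordinates at positions i >= d are 0. *)
definition int_lattice :: "nat \<Rightarrow> (nat \<Rightarrow> int) set" where
  "int_lattice d = {x. \<forall>i\<ge>d. x i = 0}"

definition hypercube :: "nat \<Rightarrow> (nat \<Rightarrow> int) set" where
  "hypercube d = {x \<in> int_lattice d. \<forall>i<d. x i \<in> {0, 1}}"

(* Functions on Z^d are represented by functions on the whole type; the definitions below
   only use their values on int_lattice d, which is closed under pointwise subtraction. *)
definition supported_in_cube :: "nat \<Rightarrow> ((nat \<Rightarrow> int) \<Rightarrow> complex) \<Rightarrow> bool" where
  "supported_in_cube d f \<longleftrightarrow> (\<forall>x \<in> int_lattice d - hypercube d. f x = 0)"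

definition convolution ::
    "nat \<Rightarrow> ((nat \<Rightarrow> int) \<Rightarrow> complex) \<Rightarrow> ((nat \<Rightarrow> int) \<Rightarrow> complex) \<Rightarrow> (nat \<Rightarrow> int) \<Rightarrow> complex" where
  "convolution d f g x = (\<Sum>\<^sub>\<infinity>y \<in> int_lattice d. f (\<lambda>i. x i - y i) * g y)"

(* Real-valued, hence meaningful only for functions with finite l^p norm on A, such as
   functions that vanish on A outside a finite set. *)
definition lp_norm :: "ereal \<Rightarrow> 'a set \<Rightarrow> ('a \<Rightarrow> complex) \<Rightarrow> real" where
  "lp_norm p A f =
     (if p = \<infinity> then (SUP x\<in>A. norm (f x))
      else (\<Sum>\<^sub>\<infinity>x\<in>A. norm (f x) powr real_of_ereal p) powr (1 / real_of_ereal p))"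

end

theory Submission
  imports Defs "HOL-Analysis.Convex" "HOL-Analysis.L2_Norm"
begin

text \<open>The constant function \<open>1\<close> on \<open>{0, 1}\<close> has self-convolution \<open>(1, 2, 1)\<close>, which gives the necessity of
  the condition. For sufficiency, Minkowski's inequality reduces the estimate to dimension one by
  slicing along the last coordinate. There, in terms of \<open>P = (ac)^p\<close>, \<open>Q = (be)^p\<close>, \<open>U = (ae)^p\<close>,
  \<open>V = (bc)^p\<close>, where \<open>PQ = UV\<close>, the worst case for fixed \<open>U\<close>, \<open>V\<close> is \<open>P = Q\<close>, i.e. \<open>g\<close> is a
  multiple of the reflection of \<open>f\<close>. What remains is a one-variable inequality: with
  \<open>M s = (x powr (1/s) + y powr (1/s)) powr s - 2 powr s * sqrt (x * y)\<close> and
  \<open>2 powr S = 2 powr q + 2\<close> it says \<open>M q \<le> M S\<close>. This follows because \<open>M\<close> increases on \<open>[2, \<infinity>)\<close> and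
  \<open>M s \<le> M 1 = M 2\<close> for \<open>s \<in> [1, 2]\<close>. For \<open>q = \<infinity>\<close> the Cauchy--Schwarz inequality suffices.\<close>

section \<open>Power sums\<close>

text \<open>After division by the total \<open>S\<close>, every ratio \<open>x i / S\<close> lies in
  [0, 1], where the power \<open>R\<close> \<ge> 1 does not increase it; the ratios sum to
  1.\<close>

lemma sum_powr_le_powr_sum:
  fixes x :: "'a \<Rightarrow> real" and R :: real
  assumes "finite A" "\<And>i. i \<in> A \<Longrightarrow> 0 \<le> x i" "1 \<le> R"
  shows "(\<Sum>i\<in>A. x i powr R) \<le> (\<Sum>i\<in>A. x i) powr R"
proof (cases "(\<Sum>i\<in>A. x i) = 0")
  case True
  then have "\<forall>i\<in>A. x i = 0"
    using assms by (simp add: sum_nonneg_eq_0_iff)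
  then show ?thesis by simp
next
  case False
  define S where "S = (\<Sum>i\<in>A. x i)"
  have S: "S > 0"
    using False assms by (simp add: S_def sum_nonneg less_le)
  have "x i powr R \<le> S powr R * (x i / S)" if "i \<in> A" for i
  proof -
    have "x i \<le> S"
      unfolding S_def using assms that by (intro member_le_sum) auto
    then have "(x i / S) powr R \<le> (x i / S) powr 1"
      using S assms that by (intro powr_mono') auto
    then have "S powr R * (x i / S) powr R \<le> S powr R * (x i / S)"
      using S assms that by (intro mult_left_mono) auto
    then show ?thesis
      using S assms that by (simp add: powr_divide)
  qed
  then have "(\<Sum>i\<in>A. x i powr R) \<le> (\<Sum>i\<in>A. S powr R * (x i / S))"
    by (rule sum_mono)
  also have "\<dots> = S powr R * ((\<Sum>i\<in>A. x i) / S)"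
    by (simp add: sum_distrib_left sum_divide_distrib)
  also have "\<dots> = S powr R"
    using S unfolding S_def by simp
  finally show ?thesis by (simp add: S_def)
qed

lemma powr_add_le_powr_sum:
  fixes x y R :: real
  assumes "0 \<le> x" "0 \<le> y" "1 \<le> R"
  shows "x powr R + y powr R \<le> (x + y) powr R"
  using sum_powr_le_powr_sum [of UNIV "\<lambda>b. if b then x else y" R] assms
  by (simp add: UNIV_bool add.commute)

text \<open>Monotonicity of l^p norms in the exponent: \<open>sum_powr_le_powr_sum\<close> for the
  numbers \<open>x i powr p\<close> and the exponent \<open>r / p\<close>.\<close>

lemma sum_powr_root_antimono:
  fixes x :: "'a \<Rightarrow> real" and p r :: real
  assumes "finite A" "\<And>i. i \<in> A \<Longrightarrow> 0 \<le> x i" "0 < p" "p \<le> r"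
  shows "(\<Sum>i\<in>A. x i powr r) powr (1 / r) \<le> (\<Sum>i\<in>A. x i powr p) powr (1 / p)"
proof -
  have "(\<Sum>i\<in>A. (x i powr p) powr (r / p)) \<le> (\<Sum>i\<in>A. x i powr p) powr (r / p)"
    using assms by (intro sum_powr_le_powr_sum) auto
  then have "(\<Sum>i\<in>A. x i powr r) powr (1 / r) \<le> ((\<Sum>i\<in>A. x i powr p) powr (r / p)) powr (1 / r)"
    using assms by (intro powr_mono2) (auto simp: powr_powr sum_nonneg)
  then show ?thesis
    using assms by (simp add: powr_powr)
qed

lemma powr_add_root_antimono:
  fixes x y p r :: real
  assumes "0 \<le> x" "0 \<le> y" "0 < p" "p \<le> r"
  shows "(x powr r + y powr r) powr (1 / r) \<le> (x powr p + y powr p) powr (1 / p)"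
  using sum_powr_root_antimono [of UNIV "\<lambda>b. if b then x else y" p r] assms
  by (simp add: UNIV_bool add.commute)

text \<open>Convexity of the power \<open>q\<close>: \<open>(x i + y i) / (A + B)\<close> is the
  mean of \<open>x i / A\<close> and \<open>y i / B\<close> with weights \<open>A / (A + B)\<close>
  and \<open>B / (A + B)\<close>. The bounds have the form in which the induction on the dimension
  supplies them.\<close>

lemma Minkowski_sum_powr:
  fixes x y :: "'a \<Rightarrow> real" and A B q :: real
  assumes "finite I" "\<And>i. i \<in> I \<Longrightarrow> 0 \<le> x i" "\<And>i. i \<in> I \<Longrightarrow> 0 \<le> y i"
    and "1 \<le> q" "0 \<le> A" "0 \<le> B"
    and A: "(\<Sum>i\<in>I. x i powr q) \<le> A powr q" and B: "(\<Sum>i\<in>I. y i powr q) \<le> B powr q"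
  shows "(\<Sum>i\<in>I. (x i + y i) powr q) \<le> (A + B) powr q"
proof -
  have zero: "\<forall>i\<in>I. z i = 0" if "(\<Sum>i\<in>I. z i powr q) \<le> 0" for z :: "'a \<Rightarrow> real"
  proof -
    have "(\<Sum>i\<in>I. z i powr q) = 0"
      using that by (intro antisym sum_nonneg) auto
    then show ?thesis
      using assms(1) by (simp add: sum_nonneg_eq_0_iff)
  qed
  consider "A = 0" | "B = 0" | "A > 0" "B > 0"
    using assms by linarith
  then show ?thesis
  proof cases
    case 1
    then show ?thesis using zero [of x] A B by simp
  next
    case 2
    then show ?thesis using zero [of y] A B by simp
  next
    case 3
    \<comment> \<open>Convexity is applied at positive points; if \<open>a\<close> or
      \<open>b\<close> is 0, what remains is \<open>w powr q\<close> \<le> \<open>w\<close> for a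
      weight \<open>w\<close> in (0, 1].\<close>
    have conv: "(u * a + v * b) powr q \<le> u * a powr q + v * b powr q"
      if "0 \<le> a" "0 \<le> b" "0 < u" "0 < v" "u + v = 1" for a b u v :: real
    proof (cases "a = 0 \<or> b = 0")
      case False
      then show ?thesis
        using powr_convex [OF \<open>1 \<le> q\<close>] that by (auto simp: convex_on_def)
    next
      case True
      have *: "(w * c) powr q \<le> w * c powr q" if "0 < w" "w \<le> 1" "0 \<le> c" for w c :: real
      proof -
        have "w powr q \<le> w powr 1" using that assms by (intro powr_mono') auto
        then show ?thesis using that by (simp add: powr_mult mult_right_mono)
      qed
      show ?thesis
        using True * [of u a] * [of v b] that assms by auto
    qed
    define C where "C = A + B"
    have C: "C > 0" using 3 by (simp add: C_def)
    have "(x i + y i) powr q \<le>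
        C powr q * (A / C * (x i powr q / A powr q) + B / C * (y i powr q / B powr q))"
      if "i \<in> I" for i
    proof -
      have "(x i + y i) powr q = (C * (A / C * (x i / A) + B / C * (y i / B))) powr q"
        using 3 C by (simp add: algebra_simps)
      also have "\<dots> = C powr q * (A / C * (x i / A) + B / C * (y i / B)) powr q"
        using 3 C assms that by (subst powr_mult) auto
      also have "\<dots> \<le> C powr q * (A / C * (x i / A) powr q + B / C * (y i / B) powr q)"
        using 3 C assms that
        by (intro mult_left_mono conv) (auto simp: C_def add_divide_distrib [symmetric])
      finally show ?thesis
        using 3 assms that by (simp add: powr_divide)
    qed
    then have "(\<Sum>i\<in>I. (x i + y i) powr q) \<le> (\<Sum>i\<in>I.
        C powr q * (A / C * (x i powr q / A powr q) + B / C * (y i powr q / B powr q)))"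
      by (rule sum_mono)
    also have "\<dots> = C powr q * (A / C * ((\<Sum>i\<in>I. x i powr q) / A powr q)
        + B / C * ((\<Sum>i\<in>I. y i powr q) / B powr q))"
      by (simp only: sum.distrib sum_distrib_left sum_divide_distrib distrib_left)
    also have "\<dots> \<le> C powr q * (A / C * 1 + B / C * 1)"
      using 3 C A B by (intro mult_left_mono add_mono) auto
    also have "\<dots> = C powr q"
      using C by (simp add: C_def add_divide_distrib [symmetric])
    finally show ?thesis by (simp add: C_def)
  qed
qed

section \<open>The two-point inequality\<close>

lemma Bernoulli_powr_le:
  fixes x s :: real
  assumes "0 \<le> s" "s \<le> 1" "0 < x"
  shows "x powr s \<le> 1 + s * (x - 1)"
  using Youngs_inequality_0 [of s "1 - s" x 1] assms by (simp add: algebra_simps)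

text \<open>Bernoulli's inequality for the exponent \<open>1 / s\<close> \<le> 1 at the point
  \<open>x powr s\<close>.\<close>

lemma Bernoulli_powr_ge:
  fixes x s :: real
  assumes "1 \<le> s" "0 < x"
  shows "1 + s * (x - 1) \<le> x powr s"
proof -
  have "x = (x powr s) powr (1 / s)"
    using assms by (simp add: powr_powr)
  also have "\<dots> \<le> 1 + (1 / s) * (x powr s - 1)"
    using assms by (intro Bernoulli_powr_le) auto
  finally show ?thesis
    using assms by (simp add: field_simps)
qed

text \<open>With \<open>b = exp (- 2 * y)\<close> the next two lemmas compare \<open>sinh (s * y)\<close> with
  \<open>sinh y * (2 * cosh y) powr (s - 1)\<close>. They are Jensen's inequality for the power \<open>s - 1\<close>
  at the points \<open>1 + b\<close> and \<open>b\<close> with weights \<open>1 - b\<close> and \<open>b\<close>, whose barycentre is \<open>1\<close>.\<close>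

lemma sinh_power_bound_le:
  fixes b s :: real
  assumes "0 < b" "b \<le> 1" "1 \<le> s" "s \<le> 2"
  shows "(1 - b) * (1 + b) powr (s - 1) + b powr s \<le> 1"
proof -
  have "b powr s = b * b powr (s - 1)"
    using assms by (simp add: powr_mult_base)
  then have "(1 - b) * (1 + b) powr (s - 1) + b powr s
      \<le> (1 - b) * (1 + (s - 1) * (1 + b - 1)) + b * (1 + (s - 1) * (b - 1))"
    using assms Bernoulli_powr_le [of "s - 1" "1 + b"] Bernoulli_powr_le [of "s - 1" b]
    by (auto intro!: add_mono mult_left_mono)
  also have "\<dots> = 1"
    by (simp add: algebra_simps)
  finally show ?thesis .
qed

lemma sinh_power_bound_ge:
  fixes b s :: real
  assumes "0 < b" "b \<le> 1" "2 \<le> s"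
  shows "1 \<le> (1 - b) * (1 + b) powr (s - 1) + b powr s"
proof -
  have "b powr s = b * b powr (s - 1)"
    using assms by (simp add: powr_mult_base)
  then have "(1 - b) * (1 + (s - 1) * (1 + b - 1)) + b * (1 + (s - 1) * (b - 1))
      \<le> (1 - b) * (1 + b) powr (s - 1) + b powr s"
    using assms Bernoulli_powr_ge [of "s - 1" "1 + b"] Bernoulli_powr_ge [of "s - 1" b]
    by (auto intro!: add_mono mult_left_mono)
  moreover have "(1 - b) * (1 + (s - 1) * (1 + b - 1)) + b * (1 + (s - 1) * (b - 1)) = 1"
    by (simp add: algebra_simps)
  ultimately show ?thesis by simp
qed

text \<open>Here \<open>z\<close> and \<open>1 / z\<close> stand for \<open>P\<close> and
  \<open>Q\<close>, scaled so that \<open>P * Q = 1\<close>, and \<open>v\<close> for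
  \<open>U + V\<close>. The gap is least at \<open>z = 1\<close>, where \<open>P = Q\<close>: its
  derivative is nonnegative by \<open>sinh_power_bound_ge\<close> with exponent
  \<open>2 * R\<close>.\<close>

lemma powr_sum_gap_ge:
  fixes z v R :: real
  assumes "1 \<le> z" "2 \<le> v" "1 \<le> R"
  shows "(2 + v) powr R - 2 \<le> (z + 1 / z + v) powr R - z powr R - z powr (- R)"
proof -
  define F where "F z = (z + 1 / z + v) powr R - z powr R - z powr (- R)" for z :: real
  have "F 1 \<le> F z"
  proof (rule DERIV_nonneg_imp_nondecreasing [OF assms(1)])
    fix x :: real assume "1 \<le> x"
    have x: "x > 0" using \<open>1 \<le> x\<close> by simp
    define D where "D = R * (x + 1 / x + v) powr (R - 1) * (1 - 1 / x\<^sup>2)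
      - R * x powr (R - 1) + R * x powr (- R - 1)"
    have "DERIV F x :> D"
      unfolding F_def D_def
      by (rule derivative_eq_intros refl | use x assms in \<open>simp add: add_pos_pos power2_eq_square field_simps\<close>)+
    moreover have "D \<ge> 0"
    proof -
      define b where "b = 1 / x"
      have b: "0 < b" "b \<le> 1" "x = 1 / b" using \<open>1 \<le> x\<close> by (auto simp: b_def)
      \<comment> \<open>The case \<open>v = 2\<close> comes first: there the base is
        \<open>x * (1 + b)\<^sup>2\<close>, which turns the exponent \<open>R - 1\<close> into
        \<open>2 * (R - 1)\<close> for \<open>1 + b\<close>. A larger \<open>v\<close> only
        increases the bound.\<close>
      have "1 - b powr (2 * R) \<le> (1 - b) * (1 + b) powr (2 * R - 1)"
        using sinh_power_bound_ge [of b "2 * R"] b assms by simp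
      also have "\<dots> = (1 - b\<^sup>2) * ((1 + b)\<^sup>2) powr (R - 1)"
      proof -
        have "(1 + b) powr (2 * R - 1) = (1 + b) powr (1 + 2 * (R - 1))" by simp
        also have "\<dots> = (1 + b) * ((1 + b)\<^sup>2) powr (R - 1)"
          using b by (simp only: powr_add) (simp add: powr_powr flip: powr_numeral)
        finally show ?thesis by (simp add: power2_eq_square algebra_simps)
      qed
      finally have "x powr (R - 1) * (1 - b powr (2 * R))
        \<le> x powr (R - 1) * ((1 - b\<^sup>2) * ((1 + b)\<^sup>2) powr (R - 1))"
        by (intro mult_left_mono) auto
      moreover have "x powr (R - 1) * ((1 + b)\<^sup>2) powr (R - 1) = (x + 1 / x + 2) powr (R - 1)"
      proof -
        have "x * (1 + b)\<^sup>2 = x + 1 / x + 2"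
          using x by (simp add: b_def power2_eq_square field_simps)
        then show ?thesis
          using x by (simp flip: powr_mult)
      qed
      moreover have "x powr (R - 1) * b powr (2 * R) = x powr (- R - 1)"
        using x by (simp add: b_def powr_divide powr_minus divide_simps flip: powr_add powr_diff)
      ultimately have "x powr (R - 1) - x powr (- R - 1)
          \<le> (1 - b\<^sup>2) * (x + 1 / x + 2) powr (R - 1)"
        by (simp add: algebra_simps)
      also have "\<dots> \<le> (1 - b\<^sup>2) * (x + 1 / x + v) powr (R - 1)"
        using x assms b by (intro mult_left_mono powr_mono2) (auto simp: power_le_one)
      finally have "R * (x powr (R - 1) - x powr (- R - 1))
          \<le> R * ((1 - b\<^sup>2) * (x + 1 / x + v) powr (R - 1))"
        using assms by (intro mult_left_mono) auto
      then show ?thesis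
        by (simp add: D_def b_def power_divide algebra_simps)
    qed
    ultimately show "\<exists>y. DERIV F x :> y \<and> y \<ge> 0" by blast
  qed
  then show ?thesis by (simp add: F_def add.commute)
qed

text \<open>With \<open>t = x powr s\<close> this is \<open>M s\<close> \<le> \<open>M 1\<close> at
  the arguments \<open>t\<close> and 1. The normalised defect \<open>K\<close> is nonincreasing up
  to 1, its derivative being a positive multiple of the expression bounded in
  \<open>sinh_power_bound_le\<close>.\<close>

lemma powr_binomial_le:
  fixes x s :: real
  assumes "0 < x" "x \<le> 1" "1 \<le> s" "s \<le> 2"
  shows "(1 + x) powr s \<le> 1 + x powr s + (2 powr s - 2) * x powr (s / 2)"
proof -
  define K where "K x = (1 + x powr s - (1 + x) powr s) * x powr (- s / 2)" for x :: real
  have "K x \<ge> K 1"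
  proof (rule DERIV_nonpos_imp_nonincreasing [OF assms(2)])
    fix y :: real assume y: "x \<le> y" "y \<le> 1"
    have "y > 0" using y assms by simp
    define D where "D = (s * y powr (s - 1) - s * (1 + y) powr (s - 1)) * y powr (- s / 2)
      + (1 + y powr s - (1 + y) powr s) * (- s / 2 * y powr (- s / 2 - 1))"
    have "DERIV K y :> D"
      unfolding K_def D_def
      by (rule derivative_eq_intros refl | use \<open>y > 0\<close> in simp)+
    moreover have "D \<le> 0"
    proof -
      have e: "y powr (- s / 2) = y * y powr (- s / 2 - 1)" "y powr s = y * y powr (s - 1)"
        "(1 + y) powr s = (1 + y) * (1 + y) powr (s - 1)"
        using \<open>y > 0\<close> by (simp_all add: powr_mult_base)
      have "D = s / 2 * y powr (- s / 2 - 1) *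
          ((1 - y) * (1 + y) powr (s - 1) + y powr s - 1)"
        unfolding D_def e by (simp add: field_simps)
      also have "\<dots> \<le> 0"
        using sinh_power_bound_le [of y s] y \<open>y > 0\<close> assms
        by (intro mult_nonneg_nonpos) auto
      finally show ?thesis .
    qed
    ultimately show "\<exists>d. DERIV K y :> d \<and> d \<le> 0" by blast
  qed
  then have "K x * x powr (s / 2) \<ge> (2 - 2 powr s) * x powr (s / 2)"
    by (intro mult_right_mono) (auto simp: K_def)
  moreover have "K x * x powr (s / 2) = 1 + x powr s - (1 + x) powr s"
    using assms by (simp add: K_def powr_minus)
  ultimately show ?thesis by (simp add: algebra_simps)
qed

text \<open>In terms of \<open>w = u / (1 + u)\<close> this says that the binary entropy of \<open>w\<close> (in bits) is at least
  \<open>4 * w * (1 - w)\<close>.\<close>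

lemma binary_entropy_lower_bound:
  fixes u :: real
  assumes "0 < u" "u \<le> 1"
  shows "4 * u * ln 2 \<le> (1 + u) * ((1 + u) * ln (1 + u) - u * ln u)"
proof -
  \<comment> \<open>\<open>H\<close> is the right-hand side divided by \<open>u\<close>, so the
    claim becomes \<open>H u\<close> \<ge> \<open>H 1\<close>, with
    \<open>H 1 = 4 * ln 2\<close>.\<close>
  define H where "H u = (u + 2 + 1 / u) * ln (1 + u) - (1 + u) * ln u" for u :: real
  have "H u \<ge> H 1"
  proof (rule DERIV_nonpos_imp_nonincreasing [OF assms(2)])
    fix y :: real assume y: "u \<le> y" "y \<le> 1"
    have "y > 0" using y assms by simp
    define D where "D = ((y\<^sup>2 - 1) * ln (1 + y) - y\<^sup>2 * ln y) / y\<^sup>2"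
    have "DERIV H y :> D"
    proof -
      have "(1 - 1 / y\<^sup>2) * ln (1 + y) + (y + 2 + 1 / y) * (1 / (1 + y))
          - (ln y + (1 + y) * (1 / y)) = D"
      proof -
        have "(y + 2 + 1 / y) * (1 / (1 + y)) = (1 + y) * (1 / y)"
          using \<open>y > 0\<close> by (simp add: divide_simps) (simp add: algebra_simps)
        moreover have "(1 - 1 / y\<^sup>2) * ln (1 + y) - ln y = D"
          using \<open>y > 0\<close> by (simp add: D_def diff_divide_distrib left_diff_distrib)
        ultimately show ?thesis by simp
      qed
      moreover have "DERIV H y :> (1 - 1 / y\<^sup>2) * ln (1 + y) + (y + 2 + 1 / y) * (1 / (1 + y))
          - (ln y + (1 + y) * (1 / y))"
        unfolding H_def using \<open>y > 0\<close>
        by (auto intro!: derivative_eq_intros simp: power2_eq_square)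
      ultimately show ?thesis by simp
    qed
    moreover have "D \<le> 0"
    proof -
      \<comment> \<open>The bound \<open>ln t\<close> \<le> \<open>t - 1\<close>, at
        \<open>1 / y\<close> and at \<open>1 / (1 + y)\<close>, places \<open>(1 - y) * y\<close>
        between the two logarithmic terms of \<open>D\<close>.\<close>
      have "- ln y \<le> 1 / y - 1"
        using ln_le_minus_one [of "1 / y"] \<open>y > 0\<close> by (simp add: ln_div)
      then have "y\<^sup>2 * (- ln y) \<le> y\<^sup>2 * (1 / y - 1)"
        by (intro mult_left_mono) auto
      also have "\<dots> = (1 - y) * y"
        using \<open>y > 0\<close> by (simp add: power2_eq_square field_simps)
      also have "\<dots> \<le> (1 - y) * ((1 + y) * ln (1 + y))"
      proof (intro mult_left_mono)
        have "- ln (1 + y) \<le> 1 / (1 + y) - 1"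
          using ln_le_minus_one [of "1 / (1 + y)"] \<open>y > 0\<close> by (simp add: ln_div)
        then have "(1 + y) * (- ln (1 + y)) \<le> (1 + y) * (1 / (1 + y) - 1)"
          using \<open>y > 0\<close> by (intro mult_left_mono) auto
        then show "y \<le> (1 + y) * ln (1 + y)"
          using \<open>y > 0\<close> by (simp add: algebra_simps)
      qed (use y in auto)
      finally have "(y\<^sup>2 - 1) * ln (1 + y) - y\<^sup>2 * ln y \<le> 0"
        by (simp add: algebra_simps power2_eq_square)
      then show ?thesis
        unfolding D_def by (intro divide_nonpos_nonneg) auto
    qed
    ultimately show "\<exists>d. DERIV H y :> d \<and> d \<le> 0" by blast
  qed
  then have "u * H u \<ge> u * (4 * ln 2)"
    using assms by (intro mult_left_mono) (auto simp: H_def)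
  moreover have "u * H u = (1 + u) * ((1 + u) * ln (1 + u) - u * ln u)"
    using assms by (simp add: H_def power2_eq_square field_simps)
  ultimately show ?thesis by (simp add: mult_ac)
qed

text \<open>This is the monotonicity of \<open>M\<close> on [2, \<infinity>) with second argument 1.
  In the derivative at \<open>r\<close>, two of the \<open>r\<close> factors are spent on the
  entropy bound and the other \<open>r - 2\<close> \<ge> 0 on \<open>2 * sqrt u\<close> \<le>
  \<open>1 + u\<close>.\<close>

lemma powr_mean_gap_mono:
  fixes x s t :: real
  assumes "0 < x" "x \<le> 1" "2 \<le> s" "s \<le> t"
  shows "(1 + x powr (1 / s)) powr s - 2 powr s * sqrt x
    \<le> (1 + x powr (1 / t)) powr t - 2 powr t * sqrt x"
proof (rule DERIV_nonneg_imp_nondecreasing [OF assms(4)])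
  fix r :: real assume r: "s \<le> r" "r \<le> t"
  then have r2: "2 \<le> r" "r > 0" using assms by auto
  define u where "u = x powr (1 / r)"
  have u: "0 < u" "u \<le> 1" using assms r2 by (auto simp: u_def powr_le1)
  have lnu: "ln u = ln x / r" using assms by (simp add: u_def ln_powr)
  have sx: "sqrt x = u powr (r / 2)" using assms r2 by (simp add: u_def powr_powr flip: powr_half_sqrt)
  define D where "D = (1 + u) powr r * (ln (1 + u) - u * ln u / (1 + u)) - 2 powr r * ln 2 * sqrt x"
  have "DERIV (\<lambda>r. (1 + x powr (1 / r)) powr r - 2 powr r * sqrt x) r :> D"
  proof -
    have "DERIV (\<lambda>r. x powr (1 / r)) r :> - u * ln u / r"
    proof -
      have "DERIV (\<lambda>r. 1 / r) r :> - 1 / r\<^sup>2"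
        using r2 by (auto intro!: derivative_eq_intros simp: power2_eq_square)
      from DERIV_powr [OF DERIV_const [of x] assms(1) this] show ?thesis
        by (simp add: lnu power2_eq_square flip: u_def)
    qed
    from DERIV_add [OF DERIV_const [of 1] this]
    have "DERIV (\<lambda>r. 1 + x powr (1 / r)) r :> - u * ln u / r" by simp
    from DERIV_powr [OF this _ DERIV_ident] u
    have "DERIV (\<lambda>r. (1 + x powr (1 / r)) powr r) r :>
        (1 + u) powr r * (1 * ln (1 + u) + (- u * ln u / r) * r / (1 + u))"
      by (simp flip: u_def)
    moreover have "DERIV (\<lambda>r. 2 powr r * sqrt x) r :> 2 powr r * ln 2 * sqrt x"
      using DERIV_cmult_right [OF DERIV_powr [OF DERIV_const [of 2] _ DERIV_ident]] by simp
    ultimately have "DERIV (\<lambda>r. (1 + x powr (1 / r)) powr r - 2 powr r * sqrt x) r :>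
        (1 + u) powr r * (1 * ln (1 + u) + (- u * ln u / r) * r / (1 + u)) - 2 powr r * ln 2 * sqrt x"
      by (rule DERIV_diff)
    then show ?thesis
      using r2 by (simp add: D_def)
  qed
  moreover have "D \<ge> 0"
  proof -
    have s: "0 < 2 * sqrt u" using u by simp
    have "2 powr r * sqrt x = (2 * sqrt u) powr r"
      using u by (simp add: sx powr_mult powr_powr flip: powr_half_sqrt)
    also have "\<dots> = (2 * sqrt u) powr (r - 2) * (4 * u)"
    proof -
      have "(2 * sqrt u) powr r = (2 * sqrt u) powr ((r - 2) + 2)" by simp
      also have "\<dots> = (2 * sqrt u) powr (r - 2) * (2 * sqrt u) powr 2" by (rule powr_add)
      finally show ?thesis using s u by (simp add: power_mult_distrib)
    qed
    finally have "2 powr r * ln 2 * sqrt x = (2 * sqrt u) powr (r - 2) * (4 * u * ln 2)"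
      by simp
    also have "\<dots> \<le> (1 + u) powr (r - 2) * ((1 + u) * ((1 + u) * ln (1 + u) - u * ln u))"
    proof (rule mult_mono)
      have "0 \<le> (1 - sqrt u)\<^sup>2" by simp
      then have "2 * sqrt u \<le> 1 + u"
        using u by (simp add: power2_eq_square algebra_simps)
      then show "(2 * sqrt u) powr (r - 2) \<le> (1 + u) powr (r - 2)"
        using u r2 by (intro powr_mono2) auto
    qed (use u binary_entropy_lower_bound [of u] in auto)
    also have "\<dots> = (1 + u) powr r * (ln (1 + u) - u * ln u / (1 + u))"
    proof -
      have "(1 + u) powr r = (1 + u) powr ((r - 2) + 2)" by simp
      also have "\<dots> = (1 + u) powr (r - 2) * (1 + u) powr 2" by (rule powr_add)
      finally have "(1 + u) powr r = (1 + u) powr (r - 2) * (1 + u)\<^sup>2" using u by simp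
      then show ?thesis using u by (simp add: power2_eq_square field_simps)
    qed
    finally show ?thesis by (simp add: D_def)
  qed
  ultimately show "\<exists>y. DERIV (\<lambda>r. (1 + x powr (1 / r)) powr r - 2 powr r * sqrt x) r :> y \<and> y \<ge> 0"
    by blast
qed

section \<open>Homogeneous forms and the two-point inequality\<close>

lemma powr_mean_scale:
  fixes x y s :: real
  assumes "0 < x" "0 < y" "0 < s"
  shows "(x powr (1 / s) + y powr (1 / s)) powr s = y * (1 + (x / y) powr (1 / s)) powr s"
proof -
  have "x powr (1 / s) + y powr (1 / s) = y powr (1 / s) * (1 + (x / y) powr (1 / s))"
    using assms by (simp add: powr_divide field_simps)
  then show ?thesis
    using assms by (simp add: powr_mult powr_powr)
qed

text \<open>Since \<open>2 powr S - 2 powr q = 2\<close>, the claim is \<open>M q\<close> \<le>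
  \<open>M S\<close>. By symmetry and homogeneity, \<open>x\<close> \<le> \<open>y\<close> may be
  assumed and \<open>y\<close> divided out.\<close>

lemma powr_mean_gap:
  fixes x y q S :: real
  assumes "0 < x" "0 < y" "1 \<le> q" "2 \<le> S" and S: "2 powr S = 2 powr q + 2"
  shows "2 * sqrt (x * y) + (x powr (1 / q) + y powr (1 / q)) powr q
    \<le> (x powr (1 / S) + y powr (1 / S)) powr S"
  using assms(1,2)
proof (induction x y rule: linorder_wlog)
  case (le x y)
  define t where "t = x / y"
  have t: "0 < t" "t \<le> 1" using le by (auto simp: t_def)
  have "2 * sqrt t + (1 + t powr (1 / q)) powr q \<le> (1 + t powr (1 / S)) powr S"
  \<comment> \<open>For \<open>q\<close> \<le> 2 the comparison passes through
    \<open>M 1 = M 2\<close>: \<open>powr_binomial_le\<close> gives \<open>M q\<close> \<le>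
    \<open>M 1\<close>, and monotonicity gives \<open>M 2\<close> \<le> \<open>M S\<close>. For
    \<open>q\<close> > 2 monotonicity applies directly, as \<open>q\<close> \<le>
    \<open>S\<close>.\<close>
  proof (cases "q \<le> 2")
    case True
    have "t powr (1 / q) \<le> 1" using t assms by (simp add: powr_le1)
    then have "(1 + t powr (1 / q)) powr q \<le> 1 + t + (2 powr q - 2) * sqrt t"
      using powr_binomial_le [of "t powr (1 / q)" q] t True assms
      by (simp add: powr_powr powr_half_sqrt)
    moreover have "(1 + t powr (1 / 2)) powr 2 - 2 powr 2 * sqrt t
        \<le> (1 + t powr (1 / S)) powr S - 2 powr S * sqrt t"
      using t assms by (intro powr_mean_gap_mono) auto
    moreover have "(1 + t powr (1 / 2)) powr 2 = 1 + t + 2 * sqrt t"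
      using t by (simp add: powr_half_sqrt add_pos_pos power2_eq_square algebra_simps)
    ultimately show ?thesis
      by (simp add: S algebra_simps)
  next
    case False
    have "q \<le> S"
      using S by (simp flip: powr_le_cancel_iff [of "2::real" q S])
    then show ?thesis
      using powr_mean_gap_mono [of t q S] t False by (simp add: S algebra_simps)
  qed
  then have "y * (2 * sqrt t + (1 + t powr (1 / q)) powr q) \<le> y * (1 + t powr (1 / S)) powr S"
    using le by (intro mult_left_mono) auto
  moreover have "y * sqrt t = sqrt (x * y)"
    using le by (simp add: t_def real_sqrt_divide real_sqrt_mult field_simps)
  ultimately show ?case
    using le assms by (simp add: powr_mean_scale algebra_simps flip: t_def)
next
  case (sym x y)
  then show ?case by (simp add: add.commute mult.commute)
qed

text \<open>Both sides are homogeneous of degree \<open>R\<close>; division by \<open>k\<close>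
  leads to \<open>powr_sum_gap_ge\<close> with \<open>z = P / k\<close>. The left-hand side is the
  value at \<open>P = Q = k\<close>.\<close>

lemma powr_sum_gap_ge_scaled:
  fixes P Q k W R :: real
  assumes "0 < P" "0 < Q" "0 < k" "P * Q = k\<^sup>2" "2 * k \<le> W" "1 \<le> R"
  shows "(2 * k + W) powr R - 2 * k powr R \<le> (P + Q + W) powr R - P powr R - Q powr R"
  using assms(1,2,4)
proof (induction P Q rule: linorder_wlog)
  case (le Q P)
  define z where "z = P / k"
  have "k\<^sup>2 \<le> P\<^sup>2"
    using le by (metis mult_right_mono less_imp_le power2_eq_square)
  then have z: "1 \<le> z"
    using assms le by (simp add: z_def power2_le_iff_abs_le)
  have PQ: "P = k * z" "Q = k * (1 / z)"
    using assms le by (auto simp: z_def power2_eq_square field_simps)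
  have "k powr R * ((2 + W / k) powr R - 2)
      \<le> k powr R * ((z + 1 / z + W / k) powr R - z powr R - z powr (- R))"
    using z assms by (intro mult_left_mono powr_sum_gap_ge) (auto simp: field_simps)
  moreover have "k powr R * (2 + W / k) powr R = (2 * k + W) powr R"
  proof -
    have "k * (2 + W / k) = 2 * k + W"
      using assms by (simp add: algebra_simps)
    then show ?thesis
      using assms by (simp flip: powr_mult)
  qed
  moreover have "k powr R * (z + 1 / z + W / k) powr R = (P + Q + W) powr R"
  proof -
    have "k * (z + 1 / z + W / k) = P + Q + W"
      unfolding PQ using assms by (simp add: algebra_simps)
    then show ?thesis
      using assms z by (simp flip: powr_mult)
  qed
  moreover have "k powr R * z powr R = P powr R" "k powr R * z powr (- R) = Q powr R"
    using assms z by (simp_all add: PQ powr_mult powr_divide powr_minus_divide)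
  ultimately show ?case by (simp add: algebra_simps)
next
  case (sym P Q)
  then show ?case by (simp add: algebra_simps)
qed

text \<open>The estimate in dimension one for nonnegative values \<open>a\<close>, \<open>b\<close>
  of \<open>f\<close> and \<open>c\<close>, \<open>e\<close> of \<open>g\<close>. Here
  \<open>p\<close> is the largest exponent that the condition allows for \<open>q\<close>, and
  \<open>R = q / p\<close>.\<close>

lemma two_point_inequality:
  fixes a b c e q R :: real
  assumes nn: "0 \<le> a" "0 \<le> b" "0 \<le> c" "0 \<le> e" and "1 \<le> q"
    and R: "R = log 2 (2 powr q + 2) / 2"
  defines "p \<equiv> q / R"
  shows "(a * c) powr q + (a * e + b * c) powr q + (b * e) powr q
    \<le> ((a powr p + b powr p) * (c powr p + e powr p)) powr R"
proof -
  \<comment> \<open>Thus \<open>2 * R\<close> is the exponent \<open>S\<close> of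
    \<open>powr_mean_gap\<close>.\<close>
  have S: "2 powr (2 * R) = 2 powr q + 2"
    by (simp add: R add_pos_pos)
  have "2 powr 2 \<le> 2 powr (2 * R)"
    unfolding S using powr_mono [of 1 q "2 :: real"] \<open>1 \<le> q\<close> by simp
  then have R1: "1 \<le> R"
    by (subst (asm) powr_le_cancel_iff) auto
  have p: "0 < p" "p * R = q"
    using R1 \<open>1 \<le> q\<close> by (auto simp: p_def)
  define P Q U V where "P = (a * c) powr p" and "Q = (b * e) powr p"
    and "U = (a * e) powr p" and "V = (b * c) powr p"
  note defs = P_def Q_def U_def V_def
  have prod: "(a powr p + b powr p) * (c powr p + e powr p) = P + Q + (U + V)"
    by (simp add: defs powr_mult algebra_simps)
  have PR: "P powr R = (a * c) powr q" "Q powr R = (b * e) powr q"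
    "U powr R = (a * e) powr q" "V powr R = (b * c) powr q"
    by (simp_all add: defs powr_powr p)
  have nonneg: "0 \<le> P" "0 \<le> Q" "0 \<le> U" "0 \<le> V"
    by (simp_all add: defs)
  show ?thesis
  proof (cases "a = 0 \<or> b = 0 \<or> c = 0 \<or> e = 0")
    case True
    \<comment> \<open>If an entry vanishes, so does \<open>a * e\<close> or \<open>b * c\<close>.
      The middle term then splits, and superadditivity of the power \<open>R\<close>
      suffices.\<close>
    then have "(a * e + b * c) powr q = (a * e) powr q + (b * c) powr q"
      using \<open>1 \<le> q\<close> by auto
    then have "(a * c) powr q + (a * e + b * c) powr q + (b * e) powr q
        = (P powr R + Q powr R) + (U powr R + V powr R)"
      by (simp add: PR)
    also have "\<dots> \<le> (P + Q) powr R + (U + V) powr R"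
      using nonneg R1 by (intro add_mono powr_add_le_powr_sum)
    also have "\<dots> \<le> (P + Q + (U + V)) powr R"
      using nonneg R1 by (intro powr_add_le_powr_sum) auto
    finally show ?thesis by (simp add: prod)
  next
    case False
    then have pos: "0 < a" "0 < b" "0 < c" "0 < e" using nn by auto
    then have PQUV: "0 < P" "0 < Q" "0 < U" "0 < V" by (simp_all add: defs)
    define k where "k = sqrt (U * V)"
    have k: "0 < k" "k\<^sup>2 = U * V" using PQUV by (auto simp: k_def)
    have "P * Q = k\<^sup>2"
      by (simp add: k defs powr_mult)
    have sq: "(sqrt U + sqrt V)\<^sup>2 = 2 * k + (U + V)" "(sqrt U - sqrt V)\<^sup>2 = U + V - 2 * k"
      using PQUV by (simp_all add: k_def power2_eq_square algebra_simps real_sqrt_mult)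
    have "2 * k \<le> U + V"
      using sq(2) zero_le_power2 [of "sqrt U - sqrt V"] by linarith
    have root: "(W powr R) powr (1 / (2 * R)) = sqrt W" "((w powr p) powr R) powr (1 / q) = w"
      if "0 < W" "0 < w" for W w
      using that R1 p \<open>1 \<le> q\<close> by (simp_all add: powr_powr powr_half_sqrt)
    \<comment> \<open>This bounds the middle term plus \<open>2 * k powr R\<close> by
      \<open>(2 * k + (U + V)) powr R\<close>, which is the claim for \<open>P = Q = k\<close>;
      \<open>powr_sum_gap_ge_scaled\<close> then passes to the actual \<open>P\<close> and
      \<open>Q\<close>.\<close>
    have "2 * sqrt (U powr R * V powr R)
        + ((U powr R) powr (1 / q) + (V powr R) powr (1 / q)) powr q
        \<le> ((U powr R) powr (1 / (2 * R)) + (V powr R) powr (1 / (2 * R))) powr (2 * R)"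
      using PQUV \<open>1 \<le> q\<close> R1 S by (intro powr_mean_gap) auto
    moreover have "sqrt (U powr R * V powr R) = k powr R"
      using PQUV by (simp add: k_def powr_mult powr_powr flip: powr_half_sqrt)
    moreover have "((U powr R) powr (1 / q) + (V powr R) powr (1 / q)) = a * e + b * c"
      unfolding U_def V_def using pos by (simp add: root)
    moreover have "((U powr R) powr (1 / (2 * R)) + (V powr R) powr (1 / (2 * R))) powr (2 * R)
        = (2 * k + (U + V)) powr R"
    proof -
      have "(sqrt U + sqrt V) powr (2 * R) = ((sqrt U + sqrt V)\<^sup>2) powr R"
        using PQUV by (simp add: powr_powr add_pos_pos flip: powr_numeral)
      then show ?thesis
        using PQUV sq by (simp add: root)
    qed
    moreover have "(2 * k + (U + V)) powr R - 2 * k powr R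
        \<le> (P + Q + (U + V)) powr R - P powr R - Q powr R"
      using PQUV k \<open>P * Q = k\<^sup>2\<close> \<open>2 * k \<le> U + V\<close> R1
      by (intro powr_sum_gap_ge_scaled) auto
    ultimately show ?thesis
      by (simp add: prod PR)
  qed
qed

section \<open>Tensorization\<close>

text \<open>\<open>K = {0, 1}\<close> gives the cube and \<open>K = {0, 1, 2}\<close> a box
  containing the support of the convolution, so that one induction on \<open>d\<close> handles
  both.\<close>

definition grid :: "nat \<Rightarrow> int set \<Rightarrow> (nat \<Rightarrow> int) set" where
  "grid d K = {x \<in> int_lattice d. \<forall>i<d. x i \<in> K}"

text \<open>A point of Z^d has the default value 0 at index \<open>d\<close>; the update at
  \<open>d\<close> moves it to the layer \<open>t\<close> of Z^(d+1).\<close>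

definition slice :: "nat \<Rightarrow> int \<Rightarrow> ((nat \<Rightarrow> int) \<Rightarrow> 'a) \<Rightarrow> (nat \<Rightarrow> int) \<Rightarrow> 'a" where
  "slice d t f = (\<lambda>x. f (x(d := t)))"

lemma hypercube_eq_grid: "hypercube d = grid d {0, 1}"
  by (simp add: hypercube_def grid_def)

lemma grid_subset_int_lattice: "grid d K \<subseteq> int_lattice d"
  by (auto simp: grid_def)

lemma grid_0: "grid 0 K = {\<lambda>_. 0}"
  by (auto simp: grid_def int_lattice_def)

lemma int_lattice_upd: "x \<in> int_lattice d \<Longrightarrow> x(d := t) \<in> int_lattice (Suc d)"
  by (auto simp: int_lattice_def)

lemma grid_upd_iff: "x \<in> int_lattice d \<Longrightarrow> x(d := t) \<in> grid (Suc d) K \<longleftrightarrow> t \<in> K \<and> x \<in> grid d K"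
  by (auto simp: grid_def int_lattice_def less_Suc_eq)

lemma grid_Suc: "grid (Suc d) K = (\<lambda>(t, x). x(d := t)) ` (K \<times> grid d K)"
proof (intro equalityI subsetI)
  fix x assume x: "x \<in> grid (Suc d) K"
  then have "x(d := 0) \<in> grid d K"
    by (auto simp: grid_def int_lattice_def Suc_le_eq)
  moreover have "x d \<in> K" "x = (x(d := 0))(d := x d)"
    using x by (auto simp: grid_def)
  ultimately show "x \<in> (\<lambda>(t, x). x(d := t)) ` (K \<times> grid d K)"
    by (metis (no_types, lifting) SigmaI case_prod_conv image_eqI)
qed (use grid_subset_int_lattice in \<open>fastforce simp: grid_upd_iff\<close>)

lemma finite_grid: "finite K \<Longrightarrow> finite (grid d K)"
  by (induction d) (auto simp: grid_0 grid_Suc)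

lemma finite_hypercube: "finite (hypercube d)"
  by (simp add: hypercube_eq_grid finite_grid)

lemma sum_grid_Suc:
  "(\<Sum>x\<in>grid (Suc d) K. h x) = (\<Sum>t\<in>K. \<Sum>x\<in>grid d K. h (x(d := t)))"
proof -
  have "inj_on (\<lambda>(t, x). x(d := t)) (K \<times> grid d K)"
  proof (rule inj_onI, clarify)
    fix s t and x y :: "nat \<Rightarrow> int"
    assume xy: "x \<in> grid d K" "y \<in> grid d K" and eq: "x(d := s) = y(d := t)"
    \<comment> \<open>Both sides are the default value 0, so the update at \<open>d\<close> loses no
      information about \<open>x\<close> or \<open>y\<close>.\<close>
    have "x d = y d" using xy by (auto simp: grid_def int_lattice_def)
    then have "x = y" using eq by (metis fun_upd_idem_iff fun_upd_upd)
    then show "s = t \<and> x = y" using eq by (metis fun_upd_same)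
  qed
  then have "(\<Sum>x\<in>grid (Suc d) K. h x) = (\<Sum>(t, x)\<in>K \<times> grid d K. h (x(d := t)))"
    by (simp add: grid_Suc sum.reindex case_prod_unfold)
  then show ?thesis
    by (simp add: sum.cartesian_product)
qed

lemma supported_in_cube_slice:
  assumes "supported_in_cube (Suc d) f"
  shows "supported_in_cube d (slice d t f)"
    and "t \<notin> {0, 1} \<Longrightarrow> x \<in> int_lattice d \<Longrightarrow> slice d t f x = 0"
  using assms
  by (auto simp: supported_in_cube_def slice_def hypercube_eq_grid grid_upd_iff int_lattice_upd
      simp del: fun_upd_apply)

section \<open>Convolutions of functions supported in the cube\<close>

lemma convolution_eq_sum:
  assumes "supported_in_cube d g"
  shows "convolution d f g x = (\<Sum>y\<in>hypercube d. f (\<lambda>i. x i - y i) * g y)"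
proof -
  have "convolution d f g x = (\<Sum>\<^sub>\<infinity>y\<in>hypercube d. f (\<lambda>i. x i - y i) * g y)"
    unfolding convolution_def using assms
    by (intro infsum_cong_neutral) (auto simp: supported_in_cube_def hypercube_def)
  then show ?thesis
    by (simp add: finite_hypercube)
qed

lemma int_lattice_diff: "x \<in> int_lattice d \<Longrightarrow> y \<in> int_lattice d \<Longrightarrow> (\<lambda>i. x i - y i) \<in> int_lattice d"
  by (simp add: int_lattice_def)

lemma convolution_eq_0:
  assumes "supported_in_cube d f" "supported_in_cube d g"
    and x: "x \<in> int_lattice d" "x \<notin> grid d {0, 1, 2}"
  shows "convolution d f g x = 0"
proof -
  have "f (\<lambda>i. x i - y i) = 0" if y: "y \<in> hypercube d" for y
  proof -
    obtain i where i: "i < d" "x i \<notin> {0, 1, 2}"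
      using x by (auto simp: grid_def)
    have "y i \<in> {0, 1}" using y i by (simp add: hypercube_def)
    then have "x i - y i \<notin> {0, 1}" using i by auto
    then have "(\<lambda>i. x i - y i) \<notin> hypercube d"
      using i by (auto simp: hypercube_def)
    moreover have "(\<lambda>i. x i - y i) \<in> int_lattice d"
      using x y by (intro int_lattice_diff) (auto simp: hypercube_def)
    ultimately show ?thesis
      using assms by (simp add: supported_in_cube_def)
  qed
  then show ?thesis
    by (simp add: convolution_eq_sum [OF assms(2)])
qed

lemma convolution_zero_left:
  assumes "\<And>y. y \<in> int_lattice d \<Longrightarrow> f y = 0" "x \<in> int_lattice d"
  shows "convolution d f g x = 0"
  unfolding convolution_def using assms by (intro infsum_0) (simp add: int_lattice_diff)

text \<open>Splitting the sum over \<open>y\<close> by its last coordinate \<open>s\<close> in {0,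
  1} leaves \<open>t - s\<close> as the last coordinate in the argument of \<open>f\<close>.\<close>

lemma convolution_Suc:
  assumes "supported_in_cube (Suc d) g"
  shows "convolution (Suc d) f g (x(d := t)) =
    convolution d (slice d t f) (slice d 0 g) x + convolution d (slice d (t - 1) f) (slice d 1 g) x"
proof -
  have "(\<lambda>i. (x(d := t)) i - (y(d := s)) i) = (\<lambda>i. x i - y i)(d := t - s)" for y s
    by auto
  then show ?thesis
    unfolding convolution_eq_sum [OF assms] convolution_eq_sum [OF supported_in_cube_slice(1) [OF assms]]
      hypercube_eq_grid sum_grid_Suc
    by (simp add: slice_def del: fun_upd_apply)
qed

text \<open>The l^p norm of \<open>f\<close> is the l^p norm of the pair of its slice norms. Hence
  \<open>two_point\<close>, applied to the slice norms of \<open>f\<close> and \<open>g\<close>,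
  carries the estimate from \<open>d\<close> to \<open>Suc d\<close> without loss in the
  constant.\<close>

lemma convolution_powr_sum_le:
  fixes p q :: real
  assumes "0 < p" "1 \<le> q"
    and two_point: "\<And>a b c e. \<lbrakk>0 \<le> a; 0 \<le> b; 0 \<le> c; 0 \<le> e\<rbrakk> \<Longrightarrow>
      (a * c) powr q + (a * e + b * c) powr q + (b * e) powr q
        \<le> ((a powr p + b powr p) powr (1 / p) * (c powr p + e powr p) powr (1 / p)) powr q"
    and "supported_in_cube d f" "supported_in_cube d g"
  shows "(\<Sum>x\<in>grid d {0, 1, 2}. norm (convolution d f g x) powr q) \<le>
    ((\<Sum>x\<in>hypercube d. norm (f x) powr p) powr (1 / p)
      * (\<Sum>x\<in>hypercube d. norm (g x) powr p) powr (1 / p)) powr q"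
  using assms(4,5)
proof (induction d arbitrary: f g)
  case 0
  then show ?case
    using \<open>0 < p\<close>
    by (simp add: convolution_eq_sum hypercube_eq_grid grid_0 norm_mult powr_powr)
next
  case (Suc d)
  define N :: "((nat \<Rightarrow> int) \<Rightarrow> complex) \<Rightarrow> real"
    where "N f = (\<Sum>x\<in>hypercube d. norm (f x) powr p) powr (1 / p)" for f
  have N_nonneg: "0 \<le> N f" for f by (simp add: N_def)
  have N_Suc: "(\<Sum>x\<in>hypercube (Suc d). norm (f x) powr p) =
      N (slice d 0 f) powr p + N (slice d 1 f) powr p" for f
    using \<open>0 < p\<close>
    by (simp add: hypercube_eq_grid sum_grid_Suc N_def slice_def powr_powr sum_nonneg
        del: fun_upd_apply)
  define C where "C i j x = norm (convolution d (slice d i f) (slice d j g) x)" for i j x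
  have C: "(\<Sum>x\<in>grid d {0, 1, 2}. C i j x powr q) \<le> (N (slice d i f) * N (slice d j g)) powr q"
    for i j
    unfolding N_def C_def using Suc.prems by (intro Suc.IH supported_in_cube_slice)
  \<comment> \<open>In the layers 0 and 2, one of the two terms of \<open>convolution_Suc\<close>
    contains the slice of \<open>f\<close> at -1 or 2, which vanishes.\<close>
  have conv0: "convolution d (slice d i f) (slice d j g) x = 0"
    if "i \<notin> {0, 1}" "x \<in> grid d K" for i j x K
    using that Suc.prems supported_in_cube_slice(2) grid_subset_int_lattice
    by (intro convolution_zero_left) blast+
  define T where "T t = (\<Sum>x\<in>grid d {0, 1, 2}. norm (convolution (Suc d) f g (x(d := t))) powr q)"
    for t
  have "T 0 = (\<Sum>x\<in>grid d {0, 1, 2}. C 0 0 x powr q)"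
    unfolding T_def C_def using Suc.prems by (intro sum.cong) (auto simp: convolution_Suc conv0)
  then have T0: "T 0 \<le> (N (slice d 0 f) * N (slice d 0 g)) powr q"
    using C by simp
  have "T 2 = (\<Sum>x\<in>grid d {0, 1, 2}. C 1 1 x powr q)"
    unfolding T_def C_def using Suc.prems by (intro sum.cong) (auto simp: convolution_Suc conv0)
  then have T2: "T 2 \<le> (N (slice d 1 f) * N (slice d 1 g)) powr q"
    using C by simp
  \<comment> \<open>Both terms survive in the middle layer; Minkowski's inequality combines their
    separate bounds.\<close>
  have "T 1 \<le> (\<Sum>x\<in>grid d {0, 1, 2}. (C 0 1 x + C 1 0 x) powr q)"
    unfolding T_def C_def using Suc.prems \<open>1 \<le> q\<close>
    by (intro sum_mono powr_mono2) (auto simp: convolution_Suc add.commute intro: norm_triangle_ineq)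
  also have "\<dots> \<le> (N (slice d 0 f) * N (slice d 1 g) + N (slice d 1 f) * N (slice d 0 g)) powr q"
    using \<open>1 \<le> q\<close> C by (intro Minkowski_sum_powr) (auto simp: N_nonneg finite_grid C_def)
  finally have T1: "T 1 \<le> \<dots>" .
  have "(\<Sum>x\<in>grid (Suc d) {0, 1, 2}. norm (convolution (Suc d) f g x) powr q) = T 0 + T 1 + T 2"
    by (simp add: sum_grid_Suc T_def)
  also have "\<dots> \<le> (N (slice d 0 f) * N (slice d 0 g)) powr q
      + (N (slice d 0 f) * N (slice d 1 g) + N (slice d 1 f) * N (slice d 0 g)) powr q
      + (N (slice d 1 f) * N (slice d 1 g)) powr q"
    using T0 T1 T2 by simp
  also have "\<dots> \<le> ((N (slice d 0 f) powr p + N (slice d 1 f) powr p) powr (1 / p)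
      * (N (slice d 0 g) powr p + N (slice d 1 g) powr p) powr (1 / p)) powr q"
    by (intro two_point N_nonneg)
  finally show ?case
    by (simp add: N_Suc)
qed

section \<open>The estimate in terms of norms\<close>

lemma lp_norm_hypercube:
  "lp_norm (ereal p) (hypercube d) f = (\<Sum>x\<in>hypercube d. norm (f x) powr p) powr (1 / p)"
  by (simp add: lp_norm_def finite_hypercube)

lemma lp_norm_convolution:
  assumes "supported_in_cube d f" "supported_in_cube d g"
  shows "lp_norm (ereal q) (int_lattice d) (convolution d f g) =
    (\<Sum>x\<in>grid d {0, 1, 2}. norm (convolution d f g x) powr q) powr (1 / q)"
proof -
  have "(\<Sum>\<^sub>\<infinity>x\<in>int_lattice d. norm (convolution d f g x) powr q)
      = (\<Sum>\<^sub>\<infinity>x\<in>grid d {0, 1, 2}. norm (convolution d f g x) powr q)"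
    using assms grid_subset_int_lattice
    by (intro infsum_cong_neutral) (auto simp: convolution_eq_0)
  then show ?thesis
    by (simp add: lp_norm_def finite_grid)
qed

text \<open>Cauchy-Schwarz. The reflection \<open>r\<close> is injective and \<open>f\<close>
  vanishes off the cube, so reflecting \<open>f\<close> does not increase its sum of squares over
  the cube.\<close>

lemma norm_convolution_le_L2:
  assumes "supported_in_cube d f" "supported_in_cube d g" "x \<in> int_lattice d"
  shows "norm (convolution d f g x) \<le>
    L2_set (\<lambda>x. norm (f x)) (hypercube d) * L2_set (\<lambda>x. norm (g x)) (hypercube d)"
proof -
  define r where "r y = (\<lambda>i. x i - y i)" for y
  have "norm (convolution d f g x) \<le> (\<Sum>y\<in>hypercube d. norm (f (r y)) * norm (g y))"
    unfolding convolution_eq_sum [OF assms(2)] r_def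
    by (rule sum_norm_le) (simp add: norm_mult)
  also have "\<dots> \<le> L2_set (\<lambda>y. norm (f (r y))) (hypercube d) * L2_set (\<lambda>x. norm (g x)) (hypercube d)"
    using L2_set_mult_ineq [of "\<lambda>y. norm (f (r y))" "\<lambda>x. norm (g x)" "hypercube d"] by simp
  also have "L2_set (\<lambda>y. norm (f (r y))) (hypercube d) \<le> L2_set (\<lambda>x. norm (f x)) (hypercube d)"
  proof -
    have inj: "inj r"
      by (rule injI) (auto simp: r_def fun_eq_iff)
    have "(\<Sum>y\<in>hypercube d. (norm (f (r y)))\<^sup>2) = (\<Sum>z\<in>r ` hypercube d. (norm (f z))\<^sup>2)"
      using inj by (subst sum.reindex) (auto intro: inj_on_subset)
    also have "\<dots> \<le> (\<Sum>z\<in>r ` hypercube d \<union> hypercube d. (norm (f z))\<^sup>2)"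
      by (intro sum_mono2) (auto simp: finite_hypercube)
    also have "\<dots> = (\<Sum>z\<in>hypercube d. (norm (f z))\<^sup>2)"
    proof (intro sum.mono_neutral_right)
      have "r ` hypercube d \<subseteq> int_lattice d"
        using assms(3) by (auto simp: r_def hypercube_def intro!: int_lattice_diff)
      then show "\<forall>z\<in>r ` hypercube d \<union> hypercube d - hypercube d. (norm (f z))\<^sup>2 = 0"
        using assms(1) by (auto simp: supported_in_cube_def)
    qed (auto simp: finite_hypercube)
    finally show ?thesis
      by (simp add: L2_set_def)
  qed
  finally show ?thesis
    by (simp add: mult_right_mono)
qed

lemma L2_set_le_powr_sum:
  fixes x :: "'a \<Rightarrow> real"
  assumes "finite A" "\<And>i. i \<in> A \<Longrightarrow> 0 \<le> x i" "0 < p" "p \<le> 2"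
  shows "L2_set x A \<le> (\<Sum>i\<in>A. x i powr p) powr (1 / p)"
proof -
  have "L2_set x A = (\<Sum>i\<in>A. x i powr 2) powr (1 / 2)"
    using assms by (simp add: L2_set_def sum_nonneg powr_half_sqrt)
  then show ?thesis
    using sum_powr_root_antimono [of A x p 2] assms by simp
qed

text \<open>The condition on \<open>p\<close> says \<open>p\<close> \<le> \<open>r\<close>, where
  \<open>r\<close> is the exponent of \<open>two_point_inequality\<close>; l^r norms are then at
  most l^p norms.\<close>

lemma two_point_inequality_general:
  fixes a b c e p q :: real
  assumes nn: "0 \<le> a" "0 \<le> b" "0 \<le> c" "0 \<le> e" and "0 < p" "1 \<le> q"
    and pq: "1 / (2 * q) * log 2 (2 powr q + 2) \<le> 1 / p"
  shows "(a * c) powr q + (a * e + b * c) powr q + (b * e) powr q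
    \<le> ((a powr p + b powr p) powr (1 / p) * (c powr p + e powr p) powr (1 / p)) powr q"
proof -
  define R where "R = log 2 (2 powr q + 2) / 2"
  define r where "r = q / R"
  have "1 < 2 powr q + 2"
    by (simp add: add_pos_pos add_strict_increasing2)
  then have "R > 0"
    by (simp add: R_def)
  have r: "0 < r" "p \<le> r" "1 / r * q = R"
    using pq \<open>0 < p\<close> \<open>1 \<le> q\<close> \<open>R > 0\<close> by (auto simp: r_def R_def field_simps)
  have "(a * c) powr q + (a * e + b * c) powr q + (b * e) powr q
    \<le> ((a powr r + b powr r) * (c powr r + e powr r)) powr R"
    unfolding r_def using nn \<open>1 \<le> q\<close> R_def by (intro two_point_inequality)
  also have "\<dots> = ((a powr r + b powr r) powr (1 / r) * (c powr r + e powr r) powr (1 / r)) powr q"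
    using r by (simp add: powr_mult powr_powr)
  also have "\<dots> \<le> ((a powr p + b powr p) powr (1 / p) * (c powr p + e powr p) powr (1 / p)) powr q"
    using nn r \<open>0 < p\<close> \<open>1 \<le> q\<close>
    by (intro powr_mono2 mult_mono powr_add_root_antimono) auto
  finally show ?thesis .
qed

lemma convolution_estimate:
  fixes p q :: real
  assumes "0 < p" "1 \<le> q" "1 / (2 * q) * log 2 (2 powr q + 2) \<le> 1 / p"
    and "supported_in_cube d f" "supported_in_cube d g"
  shows "lp_norm (ereal q) (int_lattice d) (convolution d f g)
    \<le> lp_norm (ereal p) (hypercube d) f * lp_norm (ereal p) (hypercube d) g"
proof -
  define M where "M = lp_norm (ereal p) (hypercube d) f * lp_norm (ereal p) (hypercube d) g"
  have M: "0 \<le> M" by (simp add: M_def lp_norm_hypercube)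
  have "(\<Sum>x\<in>grid d {0, 1, 2}. norm (convolution d f g x) powr q) \<le> M powr q"
    unfolding M_def lp_norm_hypercube using assms
    by (intro convolution_powr_sum_le two_point_inequality_general)
  then have "lp_norm (ereal q) (int_lattice d) (convolution d f g) \<le> (M powr q) powr (1 / q)"
    unfolding lp_norm_convolution [OF assms(4,5)] using assms
    by (intro powr_mono2) (auto intro: sum_nonneg)
  then show ?thesis
    using M assms by (simp add: powr_powr flip: M_def)
qed

lemma convolution_estimate_infinity:
  fixes p :: real
  assumes "0 < p" "p \<le> 2" "supported_in_cube d f" "supported_in_cube d g"
  shows "lp_norm \<infinity> (int_lattice d) (convolution d f g)
    \<le> lp_norm (ereal p) (hypercube d) f * lp_norm (ereal p) (hypercube d) g"
proof -
  have "norm (convolution d f g x)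
      \<le> lp_norm (ereal p) (hypercube d) f * lp_norm (ereal p) (hypercube d) g"
    if "x \<in> int_lattice d" for x
  proof -
    have "L2_set (\<lambda>x. norm (f x)) (hypercube d) * L2_set (\<lambda>x. norm (g x)) (hypercube d)
        \<le> lp_norm (ereal p) (hypercube d) f * lp_norm (ereal p) (hypercube d) g"
      unfolding lp_norm_hypercube using assms
      by (intro mult_mono L2_set_le_powr_sum) (auto simp: finite_hypercube)
    then show ?thesis
      using norm_convolution_le_L2 [OF assms(3,4) that] by linarith
  qed
  moreover have "(\<lambda>_. 0) \<in> int_lattice d" by (simp add: int_lattice_def)
  ultimately show ?thesis
    by (auto simp: lp_norm_def intro!: cSUP_least)
qed

section \<open>The extremal example\<close>

definition cube_indicator :: "nat \<Rightarrow> (nat \<Rightarrow> int) \<Rightarrow> complex" where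
  "cube_indicator d x = of_bool (x \<in> hypercube d)"

lemma supported_in_cube_indicator: "supported_in_cube d (cube_indicator d)"
  by (simp add: supported_in_cube_def cube_indicator_def)

text \<open>This identifies Z with the lattice of dimension one. The form as an update of the zero
  point fits \<open>grid_upd_iff\<close> and \<open>sum_grid_Suc\<close> at dimension 0.\<close>

definition line_point :: "int \<Rightarrow> nat \<Rightarrow> int" where
  "line_point t = (\<lambda>_. 0)(0 := t)"

lemma line_point_in_grid: "line_point t \<in> grid (Suc 0) K \<longleftrightarrow> t \<in> K"
  unfolding line_point_def by (subst grid_upd_iff) (auto simp: grid_0 int_lattice_def)

lemma line_point_in_int_lattice: "line_point t \<in> int_lattice (Suc 0)"
  using line_point_in_grid [of t UNIV] by (simp add: grid_def)

lemma sum_grid_1: "(\<Sum>x\<in>grid (Suc 0) K. h x) = (\<Sum>t\<in>K. h (line_point t))"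
  by (simp add: sum_grid_Suc grid_0 line_point_def del: fun_upd_apply)

lemma convolution_indicator_1:
  "convolution (Suc 0) (cube_indicator (Suc 0)) (cube_indicator (Suc 0)) (line_point t)
    = of_bool (t \<in> {0, 1}) + of_bool (t - 1 \<in> {0, 1})"
proof -
  have "(\<lambda>i. line_point t i - line_point s i) = line_point (t - s)" for s
    by (auto simp: line_point_def)
  then show ?thesis
    unfolding convolution_eq_sum [OF supported_in_cube_indicator] hypercube_eq_grid sum_grid_1
    by (simp add: cube_indicator_def hypercube_eq_grid line_point_in_grid)
qed

lemma lp_norm_indicator_1:
  "lp_norm (ereal p) (hypercube (Suc 0)) (cube_indicator (Suc 0)) = 2 powr (1 / p)"
  unfolding lp_norm_hypercube unfolding hypercube_eq_grid sum_grid_1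
  by (simp add: cube_indicator_def hypercube_eq_grid line_point_in_grid)

lemma lp_norm_indicator_1_infinity:
  "lp_norm \<infinity> (hypercube (Suc 0)) (cube_indicator (Suc 0)) = 1"
proof -
  have "lp_norm \<infinity> (hypercube (Suc 0)) (cube_indicator (Suc 0))
      = (SUP x\<in>hypercube (Suc 0). 1 :: real)"
    by (auto simp: lp_norm_def cube_indicator_def intro!: SUP_cong)
  moreover have "hypercube (Suc 0) \<noteq> {}"
    using line_point_in_grid [of 0 "{0, 1}"] by (auto simp: hypercube_eq_grid)
  ultimately show ?thesis by simp
qed

lemma lp_norm_convolution_indicator_1:
  "lp_norm (ereal q) (int_lattice (Suc 0))
      (convolution (Suc 0) (cube_indicator (Suc 0)) (cube_indicator (Suc 0)))
    = (2 powr q + 2) powr (1 / q)"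
  unfolding lp_norm_convolution [OF supported_in_cube_indicator supported_in_cube_indicator]
    sum_grid_1 convolution_indicator_1
  by (simp add: add.commute)

lemma lp_norm_convolution_indicator_1_infinity:
  "2 \<le> lp_norm \<infinity> (int_lattice (Suc 0))
      (convolution (Suc 0) (cube_indicator (Suc 0)) (cube_indicator (Suc 0)))"
proof -
  let ?c = "convolution (Suc 0) (cube_indicator (Suc 0)) (cube_indicator (Suc 0))"
  \<comment> \<open>A real supremum dominates the values only of a bounded function; Cauchy-Schwarz
    gives the bound. The value 2 is attained at \<open>line_point 1\<close>.\<close>
  have "bdd_above ((\<lambda>x. norm (?c x)) ` int_lattice (Suc 0))"
    using norm_convolution_le_L2 [OF supported_in_cube_indicator supported_in_cube_indicator]
    by (rule bdd_aboveI2)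
  then have "norm (?c (line_point 1)) \<le> (SUP x\<in>int_lattice (Suc 0). norm (?c x))"
    by (intro cSUP_upper line_point_in_int_lattice)
  then show ?thesis
    by (simp add: lp_norm_def convolution_indicator_1)
qed

theorem theorem6:
  fixes p q :: ereal
  assumes "p \<in> {1..\<infinity>}" and "q \<in> {1..\<infinity>}"
  shows "(\<forall>d\<ge>1. \<forall>f g :: (nat \<Rightarrow> int) \<Rightarrow> complex.
            supported_in_cube d f \<longrightarrow> supported_in_cube d g \<longrightarrow>
            lp_norm q (int_lattice d) (convolution d f g)
              \<le> lp_norm p (hypercube d) f * lp_norm p (hypercube d) g)
         \<longleftrightarrow>
         1 / p \<ge> ereal (if q = \<infinity> then 1 / 2
                        else 1 / (2 * real_of_ereal q) * log 2 (2 powr real_of_ereal q + 2))"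
    (is "?estimate \<longleftrightarrow> ?exponents")
proof
  assume ?estimate
  then have est: "lp_norm q (int_lattice (Suc 0))
      (convolution (Suc 0) (cube_indicator (Suc 0)) (cube_indicator (Suc 0)))
    \<le> lp_norm p (hypercube (Suc 0)) (cube_indicator (Suc 0))
      * lp_norm p (hypercube (Suc 0)) (cube_indicator (Suc 0))"
    using supported_in_cube_indicator by simp
  \<comment> \<open>\<open>Q\<close> is the l^q norm of (1, 2, 1). With it the threshold is
    \<open>log 2 Q / 2\<close> for finite and infinite \<open>q\<close> alike.\<close>
  define Q where "Q = (if q = \<infinity> then 2 else (2 powr real_of_ereal q + 2) powr (1 / real_of_ereal q))"
  have Q: "Q \<le> lp_norm q (int_lattice (Suc 0))
      (convolution (Suc 0) (cube_indicator (Suc 0)) (cube_indicator (Suc 0)))"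
    using assms(2) lp_norm_convolution_indicator_1_infinity
    by (cases q) (auto simp: Q_def lp_norm_convolution_indicator_1)
  have logQ: "(if q = \<infinity> then 1 / 2
      else 1 / (2 * real_of_ereal q) * log 2 (2 powr real_of_ereal q + 2)) = log 2 Q / 2"
    by (simp add: Q_def log_powr add_pos_pos)
  have "1 < Q"
    using assms(2) by (cases q) (auto simp: Q_def intro!: gr_one_powr add_strict_increasing2)
  show ?exponents
  proof (cases p)
    case (real r)
    \<comment> \<open>The indicator of {0, 1} has l^r norm \<open>2 powr (1 / r)\<close>; the
      logarithm of this estimate is the required condition.\<close>
    have "Q \<le> 2 powr (1 / r) * 2 powr (1 / r)"
      using est Q by (simp add: real lp_norm_indicator_1)
    then have "Q \<le> 2 powr (2 / r)"
      by (simp flip: powr_add)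
    then have "log 2 Q \<le> 2 / r"
      using \<open>1 < Q\<close> by (simp add: log_le_iff)
    moreover have "1 \<le> r" using assms(1) real by simp
    ultimately show ?thesis
      unfolding logQ by (simp add: real one_ereal_def)
  next
    case PInf
    \<comment> \<open>For \<open>p = \<infinity>\<close> both norms on the right of
      \<open>est\<close> are 1, contradicting \<open>1 < Q\<close>.\<close>
    then show ?thesis
      using est Q \<open>1 < Q\<close> by (simp add: lp_norm_indicator_1_infinity)
  qed (use assms(1) in auto)
next
  assume exps: ?exponents
  \<comment> \<open>The threshold is positive, whereas \<open>1 / p\<close> would be 0.\<close>
  have "p \<noteq> \<infinity>"
  proof
    assume "p = \<infinity>"
    have log_pos: "\<not> log 2 (2 powr s + 2) \<le> 0" for s :: real
      by (simp add: not_le add_strict_increasing2)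
    show False
      using exps assms(2) \<open>p = \<infinity>\<close>
      by (cases q) (auto simp: zero_ereal_def divide_le_0_iff log_pos split: if_splits)
  qed
  then obtain r where r: "p = ereal r" "1 \<le> r"
    using assms(1) by (cases p) auto
  have p: "1 / p = ereal (1 / r)"
    using r by (simp add: one_ereal_def)
  show ?estimate
  proof (cases q)
    case (real s)
    then show ?thesis
      using exps assms(2) r unfolding p by (auto intro!: convolution_estimate)
  next
    case PInf
    then show ?thesis
      using exps r unfolding p by (auto intro!: convolution_estimate_infinity simp: field_simps)
  qed (use assms(2) in auto)
qed

end
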